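(* For every $x\in\,]1/2,1[$ and every $n\ge1$, $$\mathbb{P}\Big(\frac{D_n}{n}\ge x\Big)\le P(x)\,\frac{\exp\big(-nI(x)-\{nx\}t_x\big)}{\sigma_x t_x\sqrt{2\pi n}},$$ where $t_x$ is the unique real solution of $L'(t_x)=x$, $\sigma_x^2=L''(t_x)$ (with $\sigma_x>0$), and $$P(x)=\sqrt{\frac{t_x^2+\pi^2}{t_x^2}}+\left(1+\frac1\pi+\frac{2\sqrt{t_x^2+\pi^2}}{\pi^2-4}\right)\sqrt{\frac{\pi^2(t_x^2+4)}{4}}.$$
   Context: For $n\ge1$, $D_n$ is the number of descents of a permutation $\pi_n$ chosen uniformly at random from the symmetric group on $\{1,\dots,n\}$, i.e. $D_n=\#\{k\in\{1,\dots,n-1\}:\pi_n(k)>\pi_n(k+1)\}$ (so $D_1=0$). The function $L:\mathbb{R}\to\mathbb{R}$ is $L(t)=\log\big(\frac{e^t-1}{t}\big)$ for $t\neq0$, extended by continuity with $L(0)=0$ (it is then twice differentiable and strictly convex, and $L'$ is a bijection from $\mathbb{R}$ onto $]0,1[$, so that $t_x$ is well defined). Its Fenchel–Legendre transform is $I(x)=\sup_{t\in\mathbb{R}}\{xt-L(t)\}$. For a positive real number $y$, the notation $\{y\}$ means $\{y\}=\lceil y\rceil-y$ (this is not the usual fractional part). *)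

theory Defs
  imports "HOL-Probability.Probability" "HOL-Combinatorics.Permutations"
begin

definition descents :: "nat \<Rightarrow> (nat \<Rightarrow> nat) \<Rightarrow> nat" where
  "descents n p = card {k \<in> {1..n - 1}. p k > p (k + 1)}"

definition random_perm :: "nat \<Rightarrow> (nat \<Rightarrow> nat) pmf" where
  "random_perm n = pmf_of_set {p. p permutes {1..n}}"

definition limit_cgf :: "real \<Rightarrow> real" where
  "limit_cgf t = (if t = 0 then 0 else ln ((exp t - 1) / t))"

(* A real-valued supremum: the set is bounded above, so that this is the
   Fenchel-Legendre transform, exactly when 0 < x < 1. For other x the transform is
   infinite and the value here has no meaning. *)
definition rate_fun :: "real \<Rightarrow> real" where
  "rate_fun x = (SUP t. x * t - limit_cgf t)"

(* Well defined for 0 < x < 1 because the derivative of limit_cgf is a bijection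
   from the real line onto that interval. *)
definition tilt :: "real \<Rightarrow> real" where
  "tilt x = (THE t. deriv limit_cgf t = x)"

definition tilt_sd :: "real \<Rightarrow> real" where
  "tilt_sd x = sqrt (deriv (deriv limit_cgf) (tilt x))"

(* Distance to the next integer above; differs from the library's frac. *)
definition ceil_gap :: "real \<Rightarrow> real" where
  "ceil_gap y = of_int \<lceil>y\<rceil> - y"

definition prefactor :: "real \<Rightarrow> real" where
  "prefactor x =
     sqrt (((tilt x)\<^sup>2 + pi\<^sup>2) / (tilt x)\<^sup>2)
     + (1 + 1 / pi + 2 * sqrt ((tilt x)\<^sup>2 + pi\<^sup>2) / (pi\<^sup>2 - 4))
       * sqrt (pi\<^sup>2 * ((tilt x)\<^sup>2 + 4) / 4)"

end

theory Submission
  imports Defs "HOL-Real_Asymp.Real_Asymp"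
begin

text \<open>
  The number of descents of a uniformly random permutation of \<open>n\<close> points has the law of the
  integer part of the sum \<open>S\<close> of \<open>n\<close> independent uniform variables on the unit
  interval: inserting the maximum into a permutation gives the recurrence of the Eulerian numbers,
  which is the recurrence of cardinal B-splines at integer points. Hence the probability in question
  is that of \<open>S \<ge> a\<close>, where \<open>a\<close> is \<open>n x\<close> rounded up
  (\<open>prob_descents_ge_le_tail\<close>).

  Tilt the law of \<open>S\<close> exponentially with the parameter \<open>t = tilt x\<close>. If the tilted
  density of \<open>S\<close> is bounded by \<open>B\<close>, then the density of \<open>S\<close> at
  \<open>s\<close> is at most \<open>B exp (n L(t) - t s)\<close>, where \<open>L\<close> is
  \<open>limit_cgf\<close>. Integrating from \<open>a\<close> on bounds the probability by
  \<open>B exp (n L(t) - t a) / t\<close>. Since \<open>a = n x + ceil_gap (n x)\<close> and the rate at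
  \<open>x\<close> is at most \<open>x t - L(t)\<close>, this has the exponential factor of the claim.

  It remains to bound the tilted density by a constant over its standard deviation, which is
  \<open>sqrt n\<close> times \<open>tilt_sd x\<close>. The density of a
  sum of uniform variables is log-concave (\<open>irwin_hall_log_concave\<close>), tilting preserves
  this, and a log-concave probability density never exceeds \<open>sqrt 2\<close> divided by its standard
  deviation (\<open>log_concave_sup_sq_variance_le\<close>), because its tails decay at least as fast as
  those of an exponential density with the same value and mass. So the estimate holds with the
  constant \<open>sqrt 2 * sqrt (2 * pi) = 2 * sqrt pi\<close> in place of \<open>prefactor x\<close>,
  which is at least \<open>1 + pi\<close> (\<open>prefactor_ge\<close>).
\<close>

section \<open>The density of a sum of uniform variables\<close>

text \<open>
  This is the density of the sum of \<open>m + 1\<close> independent uniform variables on the unit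
  interval, that is, the cardinal B-spline of order \<open>m + 1\<close>. Taking the three-term recurrence
  of B-splines as the definition, rather than the convolution with a uniform density, makes the link
  to permutations immediate: at integer points it is the recurrence of the Eulerian numbers. The
  convolution structure comes back as the derivative formula below. The initial interval is closed
  on the right so that the value at \<open>1\<close> is \<open>1\<close>, the probability that the
  empty permutation has no descent.
\<close>
primrec irwin_hall :: "nat \<Rightarrow> real \<Rightarrow> real" where
  "irwin_hall 0 s = of_bool (0 < s \<and> s \<le> 1)"
| "irwin_hall (Suc m) s =
     (s * irwin_hall m s + (real m + 2 - s) * irwin_hall m (s - 1)) / (real m + 1)"

lemma irwin_hall_eq_0_left: "s \<le> 0 \<Longrightarrow> irwin_hall m s = 0"
  by (induction m arbitrary: s) auto

lemma irwin_hall_eq_0_right_strict: "real m + 1 < s \<Longrightarrow> irwin_hall m s = 0"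
  by (induction m arbitrary: s) auto

text \<open>
  From the second function on, the density is continuous and the right end of its support is
  included; only the initial indicator does not vanish there.
\<close>
lemma irwin_hall_eq_0_right: "real m + 2 \<le> s \<Longrightarrow> irwin_hall (Suc m) s = 0"
  using irwin_hall_eq_0_right_strict[of m s] irwin_hall_eq_0_right_strict[of m "s - 1"]
  by (cases "s = real m + 2") auto

lemma irwin_hall_nonneg: "0 \<le> irwin_hall m s"
proof (induction m arbitrary: s)
  case (Suc m)
  consider "s \<le> 0" | "real m + 2 \<le> s" | "0 < s" "s < real m + 2" by linarith
  then show ?case
  proof cases
    case 3
    then show ?thesis using Suc by simp
  qed (use irwin_hall_eq_0_left[of s "Suc m"] irwin_hall_eq_0_right[of m s] in auto)
qed auto

lemma irwin_hall_pos:
  assumes "0 < s" "s < real m + 1"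
  shows "0 < irwin_hall m s"
  using assms
proof (induction m arbitrary: s)
  case (Suc m)
  note nn = irwin_hall_nonneg[of m s] irwin_hall_nonneg[of m "s - 1"]
  show ?case
  proof (cases "s < real m + 1 \<or> m = 0 \<and> s = 1")
    case True
    then have "0 < irwin_hall m s"
    proof
      assume "s < real m + 1"
      with Suc show ?thesis by blast
    qed simp
    then have "0 < s * irwin_hall m s" using Suc.prems by simp
    moreover have "0 \<le> (real m + 2 - s) * irwin_hall m (s - 1)" using Suc.prems nn by simp
    ultimately show ?thesis by simp
  next
    case False
    then have "1 < s" by (cases m) auto
    then have "0 < irwin_hall m (s - 1)" using Suc.prems by (intro Suc.IH) auto
    then have "0 < (real m + 2 - s) * irwin_hall m (s - 1)" using Suc.prems by simp
    moreover have "0 \<le> s * irwin_hall m s" using Suc.prems nn by simp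
    ultimately show ?thesis by simp
  qed
qed auto

text \<open>
  Truncated powers have no case distinctions to differentiate across, which is why the linear
  and the quadratic spline, the base cases of what follows, are rewritten in terms of them.
\<close>
lemma irwin_hall_1: "irwin_hall (Suc 0) s = max 0 s - 2 * max 0 (s - 1) + max 0 (s - 2)"
  by auto

lemma irwin_hall_2:
  "irwin_hall (Suc (Suc 0)) s =
     ((max 0 s)\<^sup>2 - 3 * (max 0 (s - 1))\<^sup>2 + 3 * (max 0 (s - 2))\<^sup>2 - (max 0 (s - 3))\<^sup>2) / 2"
proof -
  have sq: "u * max 0 u = (max 0 u)\<^sup>2" for u :: real
    by (auto simp: max_def power2_eq_square)
  have "irwin_hall (Suc (Suc 0)) s =
      (s * irwin_hall (Suc 0) s + (3 - s) * irwin_hall (Suc 0) (s - 1)) / 2"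
    by simp
  also have "\<dots> = (s * max 0 s - 3 * ((s - 1) * max 0 (s - 1)) + 3 * ((s - 2) * max 0 (s - 2))
        - (s - 3) * max 0 (s - 3)) / 2"
    unfolding irwin_hall_1 by (simp add: algebra_simps)
  finally show ?thesis unfolding sq .
qed

declare irwin_hall.simps(2) [simp del]

lemma DERIV_pos_part_power2: "((\<lambda>s::real. (max 0 s)\<^sup>2) has_real_derivative 2 * max 0 s) (at s)"
proof -
  consider "s < 0" | "s = 0" | "s > 0" by linarith
  then show ?thesis
  proof cases
    case 1
    have "((\<lambda>s::real. 0) has_real_derivative 2 * max 0 s) (at s)" using 1 by simp
    then show ?thesis
      by (rule has_field_derivative_transform_within_open[of _ _ _ "{..<0}"]) (use 1 in auto)
  next
    case 2
    have "((\<lambda>h::real. max 0 h) \<longlongrightarrow> max 0 0) (at 0)" by (intro tendsto_intros)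
    moreover have "(max 0 h)\<^sup>2 / h = max 0 h" for h :: real
      by (auto simp: max_def power2_eq_square)
    ultimately show ?thesis unfolding 2 DERIV_def by simp
  next
    case 3
    have "((\<lambda>s::real. s\<^sup>2) has_real_derivative 2 * max 0 s) (at s)"
      using 3 by (auto intro!: derivative_eq_intros)
    then show ?thesis
      by (rule has_field_derivative_transform_within_open[of _ _ _ "{0<..}"]) (use 3 in auto)
  qed
qed

text \<open>
  Convolution with the uniform density turns into a difference of two translates after
  differentiation. With the recurrence as the definition, the product rule produces \<open>m + 2\<close>
  copies of the claimed difference: one is explicit, and the recurrence for the lower spline, at
  \<open>s\<close> and at \<open>s - 1\<close>, gathers the others.
\<close>
lemma DERIV_irwin_hall:
  "(irwin_hall (Suc (Suc m)) has_real_derivative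
      irwin_hall (Suc m) s - irwin_hall (Suc m) (s - 1)) (at s)"
proof (induction m arbitrary: s)
  case 0
  have shift: "((\<lambda>s. (max 0 (s - c))\<^sup>2) has_real_derivative 2 * max 0 (s - c)) (at s)" for c
    using DERIV_shift[of "\<lambda>s. (max 0 s)\<^sup>2" _ s "- c"] DERIV_pos_part_power2[of "s - c"] by simp
  have "((\<lambda>s. ((max 0 s)\<^sup>2 - 3 * (max 0 (s - 1))\<^sup>2 + 3 * (max 0 (s - 2))\<^sup>2
            - (max 0 (s - 3))\<^sup>2) / 2) has_real_derivative
          (2 * max 0 s - 3 * (2 * max 0 (s - 1)) + 3 * (2 * max 0 (s - 2))
            - 2 * max 0 (s - 3)) / 2) (at s)"
    using shift[of 0] by (intro DERIV_cdivide DERIV_diff DERIV_add DERIV_cmult shift) simp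
  also have "(2 * max 0 s - 3 * (2 * max 0 (s - 1)) + 3 * (2 * max 0 (s - 2)) - 2 * max 0 (s - 3)) / 2
      = irwin_hall (Suc 0) s - irwin_hall (Suc 0) (s - 1)"
    unfolding irwin_hall_1 by (simp add: field_simps)
  finally show ?case unfolding irwin_hall_2[abs_def] .
next
  case (Suc m)
  define h where "h = irwin_hall (Suc (Suc m))"
  define g where "g = irwin_hall (Suc m)"
  have eq: "(real m + 2) * h s = s * g s + (real m + 3 - s) * g (s - 1)" for s
    unfolding h_def g_def by (simp add: irwin_hall.simps(2)[of "Suc m"] field_simps)
  have d: "(h has_real_derivative g s - g (s - 1)) (at s)" for s
    using Suc unfolding h_def g_def .
  have d1: "((\<lambda>s. h (s - 1)) has_real_derivative g (s - 1) - g (s - 2)) (at s)" for s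
    using DERIV_shift[of h _ s "- 1"] d[of "s - 1"] by simp
  have "((\<lambda>s. (s * h s + (real m + 4 - s) * h (s - 1)) / (real m + 3)) has_real_derivative
      (h s + s * (g s - g (s - 1)) + (- h (s - 1) + (real m + 4 - s) * (g (s - 1) - g (s - 2))))
        / (real m + 3)) (at s)"
    by (intro DERIV_cdivide) (auto intro!: derivative_eq_intros d d1 simp: algebra_simps)
  also have "h s + s * (g s - g (s - 1)) + (- h (s - 1) + (real m + 4 - s) * (g (s - 1) - g (s - 2)))
    = (real m + 3) * (h s - h (s - 1))"
    using eq[of s] eq[of "s - 1"] by (simp add: algebra_simps)
  also have "\<dots> / (real m + 3) = h s - h (s - 1)" by simp
  also have "(\<lambda>s. (s * h s + (real m + 4 - s) * h (s - 1)) / (real m + 3))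
      = irwin_hall (Suc (Suc (Suc m)))"
    by (rule ext) (simp add: irwin_hall.simps(2)[of "Suc (Suc m)"] h_def add_ac)
  finally show ?case unfolding h_def .
qed

lemma continuous_irwin_hall: "continuous_on A (irwin_hall (Suc m))"
proof (cases m)
  case 0
  have "continuous_on A (\<lambda>s::real. max 0 s - 2 * max 0 (s - 1) + max 0 (s - 2))"
    by (intro continuous_intros)
  then show ?thesis unfolding 0 irwin_hall_1[abs_def] .
next
  case (Suc k)
  show ?thesis unfolding Suc
    by (rule DERIV_continuous_on[OF has_field_derivative_at_within[OF DERIV_irwin_hall]])
qed

text \<open>
  By the derivative formula the sum of the unit translates of a spline telescopes to minus the
  lower spline. So this is the tail integral of the density \<open>irwin_hall (Suc m)\<close> from
  \<open>s\<close> on, for \<open>s \<ge> -1\<close>. The number of summands is the least one for which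
  the far end of the telescope has left the support for all these \<open>s\<close>.
\<close>
definition irwin_hall_tail :: "nat \<Rightarrow> real \<Rightarrow> real" where
  "irwin_hall_tail m s = (\<Sum>j<m + 3. irwin_hall (Suc (Suc m)) (s + 1 + real j))"

lemma DERIV_irwin_hall_tail:
  assumes "-1 \<le> s"
  shows "(irwin_hall_tail m has_real_derivative - irwin_hall (Suc m) s) (at s)"
proof -
  define h where "h = irwin_hall (Suc m)"
  define H where "H = irwin_hall (Suc (Suc m))"
  have d: "((\<lambda>s. H (s + 1 + real j)) has_real_derivative h (s + real (Suc j)) - h (s + real j)) (at s)"
    for j
    using DERIV_shift[of H _ s "1 + real j"] DERIV_irwin_hall[of m "s + (1 + real j)"]
    unfolding H_def h_def by (simp add: add_ac)
  have "((\<lambda>s. \<Sum>j<m + 3. H (s + 1 + real j)) has_real_derivative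
           (\<Sum>j<m + 3. h (s + real (Suc j)) - h (s + real j))) (at s)"
    by (intro DERIV_sum d)
  also have "(\<Sum>j<m + 3. h (s + real (Suc j)) - h (s + real j)) = h (s + real (m + 3)) - h (s + real 0)"
    by (rule sum_lessThan_telescope)
  also have "h (s + real (m + 3)) = 0"
    unfolding h_def using assms by (intro irwin_hall_eq_0_right) auto
  finally show ?thesis unfolding H_def h_def irwin_hall_tail_def[abs_def] by simp
qed

lemma irwin_hall_tail_diff:
  assumes "0 \<le> s"
  shows "irwin_hall_tail m (s - 1) - irwin_hall_tail m s = irwin_hall (Suc (Suc m)) s"
proof -
  define H where "H = irwin_hall (Suc (Suc m))"
  have "irwin_hall_tail m s - irwin_hall_tail m (s - 1)
      = (\<Sum>j<m + 3. H (s + real (Suc j)) - H (s + real j))"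
    unfolding irwin_hall_tail_def sum_subtractf H_def[symmetric] by (simp add: add_ac)
  also have "\<dots> = H (s + real (m + 3)) - H (s + real 0)"
    by (rule sum_lessThan_telescope)
  also have "H (s + real (m + 3)) = 0"
    unfolding H_def using assms by (intro irwin_hall_eq_0_right) auto
  finally show ?thesis unfolding H_def by simp
qed

lemma irwin_hall_tail_eq_0: "real m + 2 \<le> s \<Longrightarrow> irwin_hall_tail m s = 0"
  unfolding irwin_hall_tail_def by (intro sum.neutral ballI irwin_hall_eq_0_right) auto

text \<open>
  Log-concavity, in a form without logarithms that stays meaningful where the density vanishes. The
  step from \<open>h\<close> to \<open>H(s) = \<integral> h(s - w) dw\<close> over the unit interval
  amounts to \<open>H'/H\<close> being decreasing. Written as one integral over \<open>w\<close>, the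
  expression \<open>H'(x) H(y) - H'(y) H(x)\<close> has the integrand
  \<open>(h(x) h(y - w) - h(y) h(x - w)) + (h(y - 1) h(x - w) - h(x - 1) h(y - w))\<close>, and both
  brackets are nonnegative by log-concavity of \<open>h\<close>. The tent function is checked by hand
  because the derivative formula fails at its kinks.
\<close>
lemma irwin_hall_log_concave:
  assumes "x \<le> y" "0 \<le> d"
  shows "irwin_hall (Suc m) x * irwin_hall (Suc m) (y + d)
           \<le> irwin_hall (Suc m) (x + d) * irwin_hall (Suc m) y"
  using assms
proof (induction m arbitrary: x y d)
  case 0
  define g :: "real \<Rightarrow> real" where "g = (\<lambda>s. max 0 (min s (2 - s)))"
  have g: "irwin_hall (Suc 0) s = g s" for s
    unfolding irwin_hall_1 g_def by (simp add: max_def min_def)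
  show ?case
  proof (cases "0 < x \<and> y + d < 2")
    case False
    then have "g x = 0 \<or> g (y + d) = 0" by (auto simp: g_def)
    then show ?thesis unfolding g by (auto simp: g_def)
  next
    case True
    have l: "g s \<le> s" "g s \<le> 2 - s" if "0 < s" "s < 2" for s
      using that by (auto simp: g_def)
    consider "x + d \<le> 1" "y \<le> 1" | "1 \<le> x + d" "1 \<le> y" | "x + d \<le> 1" "1 \<le> y" | "1 \<le> x + d" "y \<le> 1"
      by linarith
    then have "g x * g (y + d) \<le> g (x + d) * g y"
    proof cases
      case 1
      then have "g x * g (y + d) \<le> x * (y + d)"
        using True 0 l by (intro mult_mono) (auto simp: g_def)
      also have "\<dots> \<le> (x + d) * y" using mult_right_mono[OF 0] by (simp add: algebra_simps)
      also have "\<dots> = g (x + d) * g y" using 1 True 0 by (simp add: g_def)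
      finally show ?thesis .
    next
      case 2
      then have "g x * g (y + d) \<le> (2 - x) * (2 - (y + d))"
        using True 0 l by (intro mult_mono) (auto simp: g_def)
      also have "\<dots> \<le> (2 - (x + d)) * (2 - y)"
        using mult_right_mono[OF 0] by (simp add: algebra_simps)
      also have "\<dots> = g (x + d) * g y" using 2 True 0 by (simp add: g_def)
      finally show ?thesis .
    next
      case 3
      then have "g x * g (y + d) \<le> x * (2 - (y + d))"
        using True 0 l by (intro mult_mono) (auto simp: g_def)
      also have "\<dots> \<le> (x + d) * (2 - y)"
        using 3 True 0 by (intro mult_mono) auto
      also have "\<dots> = g (x + d) * g y" using 3 True 0 by (simp add: g_def)
      finally show ?thesis .
    next
      case 4
      then have "g x * g (y + d) \<le> x * (2 - (y + d))"
        using True 0 l by (intro mult_mono) (auto simp: g_def)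
      also have "\<dots> \<le> (2 - (x + d)) * y"
        using True 0 mult_nonneg_nonneg[of "y - x" "2 - d"]
        by (simp add: algebra_simps)
      also have "\<dots> = g (x + d) * g y" using 4 True 0 by (simp add: g_def)
      finally show ?thesis .
    qed
    then show ?thesis unfolding g .
  qed
next
  case (Suc m)
  define h where "h = irwin_hall (Suc m)"
  define H where "H = irwin_hall (Suc (Suc m))"
  have IH: "h x * h (y + d) \<le> h (x + d) * h y" if "x \<le> y" "0 \<le> d" for x y d
    using Suc.IH[OF that] unfolding h_def .
  have d: "(H has_real_derivative h s - h (s - 1)) (at s)" for s
    unfolding H_def h_def by (rule DERIV_irwin_hall)
  have ratio: "(h y - h (y - 1)) * H x \<le> (h x - h (x - 1)) * H y" if "0 \<le> x" "x \<le> y" for x y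
  proof -
    \<comment> \<open>The integral over \<open>w\<close> is expressed as the increment of its antiderivative
        \<open>\<Phi>\<close>, built from the tail function.\<close>
    define T where "T = irwin_hall_tail m"
    define \<Phi> where "\<Phi> = (\<lambda>w. (h x - h (x - 1)) * T (y - w) - (h y - h (y - 1)) * T (x - w))"
    have dT: "((\<lambda>w. T (z - w)) has_real_derivative h (z - w)) (at w)" if "-1 \<le> z - w" for z w
    proof -
      have "((\<lambda>w. T (z - w)) has_real_derivative - h (z - w) * (0 - 1)) (at w)"
        unfolding T_def h_def
        by (rule DERIV_chain2[where f = "irwin_hall_tail m" and g = "\<lambda>w. z - w"])
           (intro DERIV_irwin_hall_tail that DERIV_diff DERIV_const DERIV_ident)+
      then show ?thesis by simp
    qed
    have "\<Phi> 0 \<le> \<Phi> 1"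
    proof (rule DERIV_nonneg_imp_nondecreasing[of 0 1 \<Phi>])
      fix w :: real assume w: "0 \<le> w" "w \<le> 1"
      have "(\<Phi> has_real_derivative (h x - h (x - 1)) * h (y - w) - (h y - h (y - 1)) * h (x - w)) (at w)"
        unfolding \<Phi>_def using w that by (intro DERIV_diff DERIV_cmult dT) auto
      moreover have "h (x - w) * h y \<le> h x * h (y - w)"
        using IH[of "x - w" "y - w" w] that w by simp
      moreover have "h (x - 1) * h (y - w) \<le> h (x - w) * h (y - 1)"
        using IH[of "x - 1" "y - 1" "1 - w"] that w by simp
      ultimately show "\<exists>z. (\<Phi> has_real_derivative z) (at w) \<and> 0 \<le> z"
        by (intro exI conjI) (auto simp: algebra_simps)
    qed simp
    moreover have "T (x - 1) - T x = H x" "T (y - 1) - T y = H y"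
      unfolding T_def H_def using that by (intro irwin_hall_tail_diff; simp)+
    moreover have "\<Phi> 1 - \<Phi> 0 = (h x - h (x - 1)) * (T (y - 1) - T y) - (h y - h (y - 1)) * (T (x - 1) - T x)"
      unfolding \<Phi>_def by (simp add: algebra_simps)
    ultimately show ?thesis by simp
  qed
  have nn: "0 \<le> H s" for s unfolding H_def by (rule irwin_hall_nonneg)
  have "H x * H (y + d) \<le> H (x + d) * H y"
  proof (cases "0 < x \<and> y + d < real m + 3")
    case False
    then have "H x = 0 \<or> H (y + d) = 0"
      unfolding H_def using irwin_hall_eq_0_left[of x] irwin_hall_eq_0_right[of "Suc m" "y + d"]
      by (auto)
    then show ?thesis using nn by auto
  next
    case True
    have pos: "0 < H s" if "x \<le> s" "s \<le> y" for s
      unfolding H_def using that True Suc.prems by (intro irwin_hall_pos) auto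
    have "H (y + d) / H y \<le> H (x + d) / H x"
    proof (rule DERIV_nonpos_imp_nonincreasing[OF Suc.prems(1)])
      fix s assume s: "x \<le> s" "s \<le> y"
      have "((\<lambda>s. H (s + d)) has_real_derivative h (s + d) - h (s + d - 1)) (at s)"
        using DERIV_shift[of H _ s d] d[of "s + d"] by simp
      then have "((\<lambda>s. H (s + d) / H s) has_real_derivative
          ((h (s + d) - h (s + d - 1)) * H s - H (s + d) * (h s - h (s - 1))) / (H s * H s)) (at s)"
        using pos[OF s] d by (intro DERIV_divide) auto
      moreover have "(h (s + d) - h (s + d - 1)) * H s \<le> (h s - h (s - 1)) * H (s + d)"
        using s True Suc.prems by (intro ratio) auto
      ultimately show "\<exists>z. ((\<lambda>s. H (s + d) / H s) has_real_derivative z) (at s) \<and> z \<le> 0"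
        using pos[OF s] by (intro exI conjI) (auto simp: divide_nonpos_pos algebra_simps)
    qed
    then show ?thesis using pos[of x] pos[of y] Suc.prems by (simp add: field_simps)
  qed
  then show ?case unfolding H_def .
qed

section \<open>The maximum of a log-concave density\<close>

text \<open>
  A log-concave density has an increasing hazard rate. Hence its tail, the mass beyond
  \<open>y\<close>, is at most \<open>p exp (- k y)\<close>, where \<open>p\<close> is the total mass and
  \<open>k = f 0 / p\<close> the hazard rate at \<open>0\<close>. The second moment is the integral of
  \<open>2 y\<close> times the tail, so it is at most \<open>2 p / k\<^sup>2\<close>, the value for the
  exponential density.
\<close>
lemma second_moment_le_log_concave:
  fixes f :: "real \<Rightarrow> real"
  assumes cont: "continuous_on {0..b} f" and b: "0 \<le> b"
    and nonneg: "\<And>s. 0 \<le> s \<Longrightarrow> 0 \<le> f s" and supp: "\<And>s. b \<le> s \<Longrightarrow> f s = 0"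
    and lc: "\<And>s u. 0 \<le> s \<Longrightarrow> 0 \<le> u \<Longrightarrow> f 0 * f (s + u) \<le> f s * f u"
  shows "(f 0)\<^sup>2 * integral {0..b} (\<lambda>s. s\<^sup>2 * f s) \<le> 2 * (integral {0..b} f) ^ 3"
proof (cases "f 0 = 0")
  case True
  have "0 \<le> integral {0..b} f"
    using nonneg by (intro integral_nonneg integrable_continuous_real cont) auto
  with True show ?thesis by simp
next
  case False
  define p where "p = integral {0..b} f"
  define Q where "Q = (\<lambda>y. integral {0..y} f)"
  define S where "S = (\<lambda>y. integral {0..y} (\<lambda>s. s\<^sup>2 * f s))"
  define k where "k = f 0 / p"
  have f0: "0 < f 0" using False nonneg[of 0] by simp
  have "b \<noteq> 0" using supp[of b] False by auto
  then have b0: "0 < b" using b by simp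
  have int: "f integrable_on {c..d}" if "0 \<le> c" "d \<le> b" for c d
    using that by (intro integrable_continuous_real continuous_on_subset[OF cont]) auto
  have cS: "continuous_on {0..b} (\<lambda>s. s\<^sup>2 * f s)"
    by (intro continuous_intros cont)
  have dQ: "(Q has_real_derivative f y) (at y within {0..b})" if "0 \<le> y" "y \<le> b" for y
    unfolding Q_def using integral_has_real_derivative[OF cont, of y] that by simp
  have dS: "(S has_real_derivative y\<^sup>2 * f y) (at y within {0..b})" if "0 \<le> y" "y \<le> b" for y
    unfolding S_def using integral_has_real_derivative[OF cS, of y] that by simp
  have dQ': "(Q has_real_derivative f y) (at y)" if "0 < y" "y < b" for y
    using dQ[of y] that by (simp add: at_within_Icc_at)
  have dS': "(S has_real_derivative y\<^sup>2 * f y) (at y)" if "0 < y" "y < b" for y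
    using dS[of y] that by (simp add: at_within_Icc_at)
  have cQ: "continuous_on {0..b} Q"
    by (rule DERIV_continuous_on[OF dQ]) auto
  have cS': "continuous_on {0..b} S"
    by (rule DERIV_continuous_on[OF dS]) auto
  have Qb: "Q b = p" "S 0 = 0" "Q 0 = 0" by (simp_all add: Q_def S_def p_def)
  have p0: "0 < p"
  proof -
    have "0 \<le> p" unfolding p_def using nonneg by (intro integral_nonneg int) auto
    moreover have "p \<noteq> 0"
    proof
      assume "p = 0"
      then have "\<forall>x\<in>{0..b}. f x = 0"
        using integral_eq_0_iff[OF cont] nonneg b0 unfolding p_def by auto
      then show False using False b0 by auto
    qed
    ultimately show ?thesis by simp
  qed
  have k0: "0 < k" using f0 p0 by (simp add: k_def)
  \<comment> \<open>Integrate \<open>f 0 * f (y + u) \<le> f y * f u\<close> over \<open>u\<close>.\<close>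
  have hazard: "k * (p - Q y) \<le> f y" if y: "0 \<le> y" "y \<le> b" for y
  proof -
    have tail: "p - Q y = integral {y..b} f"
      using Henstock_Kurzweil_Integration.integral_combine[OF y int] unfolding p_def Q_def by simp
    have "(f has_integral (p - Q y)) {y..b}" unfolding tail using y int by (intro integrable_integral) auto
    then have shifted: "((\<lambda>u. f (u + y)) has_integral (p - Q y)) {0..b - y}"
      using has_integral_shift_real_ivl[of f "p - Q y" y b y] by simp
    have "f 0 * (p - Q y) \<le> f y * Q (b - y)"
    proof (rule has_integral_le)
      show "((\<lambda>u. f 0 * f (u + y)) has_integral f 0 * (p - Q y)) {0..b - y}"
        by (intro has_integral_mult_right shifted)
      show "((\<lambda>u. f y * f u) has_integral f y * Q (b - y)) {0..b - y}"
        unfolding Q_def using y by (intro has_integral_mult_right integrable_integral int) auto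
      show "f 0 * f (u + y) \<le> f y * f u" if "u \<in> {0..b - y}" for u
        using lc[of y u] y that by (simp add: add.commute)
    qed
    also have "Q (b - y) \<le> p"
      unfolding Q_def p_def using y nonneg by (intro integral_subset_le int) auto
    finally have "f 0 * (p - Q y) \<le> f y * p" using nonneg[OF y(1)] by (simp add: mult_left_mono)
    then show ?thesis using p0 by (simp add: k_def field_simps)
  qed
  have tail_le: "p - Q y \<le> p * exp (- k * y)" if y: "0 \<le> y" "y \<le> b" for y
  proof -
    have "(p - Q y) * exp (k * y) \<le> (p - Q 0) * exp (k * 0)"
    proof (rule DERIV_nonpos_imp_decreasing_open[OF y(1)])
      fix z assume z: "0 < z" "z < y"
      then have "((\<lambda>z. (p - Q z) * exp (k * z)) has_real_derivative
          (0 - f z) * exp (k * z) + exp (k * z) * k * (p - Q z)) (at z)"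
        using dQ'[of z] y by (auto intro!: derivative_eq_intros)
      moreover have "(0 - f z) * exp (k * z) + exp (k * z) * k * (p - Q z)
          = (k * (p - Q z) - f z) * exp (k * z)" by (simp add: algebra_simps)
      moreover have "\<dots> \<le> 0" using hazard[of z] z y by (intro mult_nonpos_nonneg) auto
      ultimately show "\<exists>D. ((\<lambda>z. (p - Q z) * exp (k * z)) has_real_derivative D) (at z) \<and> D \<le> 0"
        by metis
    qed (use y in \<open>auto intro!: continuous_intros continuous_on_subset[OF cQ]\<close>)
    then show ?thesis using Qb by (simp add: exp_minus field_simps)
  qed
  define c where "c = 2 * p / k\<^sup>2"
  have ck: "c * k\<^sup>2 = 2 * p" using k0 by (simp add: c_def)
  \<comment> \<open>The first two summands integrate \<open>2 y (p - Q y)\<close> by parts; the last one has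
      the derivative \<open>- 2 y p exp (- k y)\<close> and so accounts for the exponential bound.\<close>
  define W where "W = (\<lambda>y. S y + y\<^sup>2 * (p - Q y) + c * ((1 + k * y) * exp (- k * y)))"
  have "W b \<le> W 0"
  proof (rule DERIV_nonpos_imp_decreasing_open[OF b])
    fix z assume z: "0 < z" "z < b"
    have "(W has_real_derivative z\<^sup>2 * f z + (2 * z * (p - Q z) + (0 - f z) * z\<^sup>2)
        + c * (k * exp (- k * z) + exp (- k * z) * (- k) * (1 + k * z))) (at z)"
      unfolding W_def using z
      by (auto intro!: derivative_eq_intros dQ'[of z] dS'[of z])
    moreover have "z\<^sup>2 * f z + (2 * z * (p - Q z) + (0 - f z) * z\<^sup>2)
        + c * (k * exp (- k * z) + exp (- k * z) * (- k) * (1 + k * z))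
        = 2 * z * (p - Q z) - c * k\<^sup>2 * (z * exp (- k * z))"
      by (simp add: algebra_simps power2_eq_square)
    moreover have "\<dots> = 2 * z * ((p - Q z) - p * exp (- k * z))"
      unfolding ck by (simp add: algebra_simps)
    moreover have "\<dots> \<le> 0" using tail_le[of z] z by (intro mult_nonneg_nonpos) auto
    ultimately show "\<exists>D. (W has_real_derivative D) (at z) \<and> D \<le> 0"
      by metis
  qed (unfold W_def, intro continuous_intros cQ cS')
  moreover have "S b \<le> W b"
    unfolding W_def Qb using b k0 p0 by (simp add: c_def)
  moreover have "W 0 = 2 * p / k\<^sup>2" by (simp add: W_def c_def Qb)
  ultimately have "S b \<le> 2 * p / k\<^sup>2" by simp
  then have "S b * (f 0)\<^sup>2 \<le> 2 * p ^ 3"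
    using f0 p0 unfolding k_def by (simp add: field_simps power2_eq_square power3_eq_cube)
  then show ?thesis unfolding S_def p_def by (simp add: mult.commute)
qed


text \<open>
  The one-sided estimate applies on both sides of \<open>c\<close>, with masses \<open>p\<close> and
  \<open>q\<close>, and \<open>p\<^sup>3 + q\<^sup>3 \<le> (p + q)\<^sup>3\<close>. For a probability
  density the result says that its value at any point is at most \<open>sqrt 2\<close> divided by the
  standard deviation, since the second moment about \<open>c\<close> is at least the variance.
\<close>
lemma log_concave_sup_sq_variance_le:
  fixes f :: "real \<Rightarrow> real"
  assumes cont: "continuous_on UNIV f" and nonneg: "\<And>s. 0 \<le> f s"
    and supp: "\<And>s. s \<le> 0 \<Longrightarrow> f s = 0" "\<And>s. b \<le> s \<Longrightarrow> f s = 0"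
    and lc: "\<And>x y d. x \<le> y \<Longrightarrow> 0 \<le> d \<Longrightarrow> f x * f (y + d) \<le> f (x + d) * f y"
    and c: "0 \<le> c" "c \<le> b"
  shows "(f c)\<^sup>2 * integral {0..b} (\<lambda>s. (s - c)\<^sup>2 * f s) \<le> 2 * (integral {0..b} f) ^ 3"
proof -
  have int: "f integrable_on {u..v}" "(\<lambda>s. (s - c)\<^sup>2 * f s) integrable_on {u..v}" for u v
    by (intro integrable_continuous_real continuous_intros continuous_on_subset[OF cont]; simp)+
  have right: "integral {0..b - c} (\<lambda>s. g (c + s)) = integral {c..b} g"
    if "g integrable_on {c..b}" for g :: "real \<Rightarrow> real"
  proof -
    have "((\<lambda>s. g (s + c)) has_integral integral {c..b} g) {c - c..b - c}"
      by (intro has_integral_shift_real_ivl integrable_integral that)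
    then show ?thesis by (auto dest!: integral_unique simp: add.commute)
  qed
  have left: "integral {0..c} (\<lambda>s. g (c - s)) = integral {0..c} g"
    if "g integrable_on {0..c}" for g :: "real \<Rightarrow> real"
  proof -
    have "((\<lambda>s. g (- s)) has_integral integral {0..c} g) {-c..-0}"
      using integrable_integral[OF that] by (simp only: has_integral_reflect_real)
    then have "((\<lambda>s. g (- (s + - c))) has_integral integral {0..c} g) {-c - - c..-0 - - c}"
      by (rule has_integral_shift_real_ivl)
    then show ?thesis by (auto dest!: integral_unique)
  qed
  define p q where "p = integral {c..b} f" and "q = integral {0..c} f"
  have "(f (c + 0))\<^sup>2 * integral {0..b - c} (\<lambda>s. s\<^sup>2 * f (c + s))
      \<le> 2 * (integral {0..b - c} (\<lambda>s. f (c + s))) ^ 3"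
  proof (rule second_moment_le_log_concave)
    show "f (c + 0) * f (c + (s + u)) \<le> f (c + s) * f (c + u)" if "0 \<le> s" "0 \<le> u" for s u
      using lc[of c "c + u" s] that by (simp add: add_ac)
  qed (use c nonneg supp in \<open>auto intro!: continuous_on_compose2[OF cont] continuous_intros\<close>)
  then have R: "(f c)\<^sup>2 * integral {c..b} (\<lambda>s. (s - c)\<^sup>2 * f s) \<le> 2 * p ^ 3"
    using right[OF int(1)] right[OF int(2)] by (simp add: p_def)
  have "(f (c - 0))\<^sup>2 * integral {0..c} (\<lambda>s. s\<^sup>2 * f (c - s))
      \<le> 2 * (integral {0..c} (\<lambda>s. f (c - s))) ^ 3"
  proof (rule second_moment_le_log_concave)
    show "f (c - 0) * f (c - (s + u)) \<le> f (c - s) * f (c - u)" if "0 \<le> s" "0 \<le> u" for s u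
      using lc[of "c - (s + u)" "c - u" u] that by (simp add: algebra_simps)
  qed (use c nonneg supp in \<open>auto intro!: continuous_on_compose2[OF cont] continuous_intros\<close>)
  then have L: "(f c)\<^sup>2 * integral {0..c} (\<lambda>s. (s - c)\<^sup>2 * f s) \<le> 2 * q ^ 3"
    using left[OF int(1)] left[OF int(2)] by (simp add: q_def)
  have pq: "0 \<le> p" "0 \<le> q" unfolding p_def q_def using nonneg int by (auto intro!: integral_nonneg)
  have "(f c)\<^sup>2 * integral {0..b} (\<lambda>s. (s - c)\<^sup>2 * f s) \<le> 2 * (p ^ 3 + q ^ 3)"
  proof -
    have "(f c)\<^sup>2 * integral {0..b} (\<lambda>s. (s - c)\<^sup>2 * f s)
        = (f c)\<^sup>2 * integral {0..c} (\<lambda>s. (s - c)\<^sup>2 * f s)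
          + (f c)\<^sup>2 * integral {c..b} (\<lambda>s. (s - c)\<^sup>2 * f s)"
      unfolding Henstock_Kurzweil_Integration.integral_combine[OF c int(2), symmetric]
      by (rule distrib_left)
    then show ?thesis using add_mono[OF L R] by (simp add: distrib_left add.commute)
  qed
  also have "\<dots> \<le> 2 * (q + p) ^ 3"
    using pq by (simp add: power3_eq_cube algebra_simps)
  also have "q + p = integral {0..b} f"
    using Henstock_Kurzweil_Integration.integral_combine[OF c int(1)] by (simp add: p_def q_def)
  finally show ?thesis .
qed

section \<open>Exponential tilting\<close>

text \<open>
  The moment generating function of a sum of \<open>m + 2\<close> independent uniform variables. The
  induction integrates the derivative of \<open>exp (t s) H(s)\<close>, which gives zero because
  \<open>H\<close> vanishes at both ends; the difference of translates in \<open>H'\<close> contributes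
  the factor \<open>exp t - 1\<close>.
\<close>
lemma irwin_hall_mgf:
  assumes t: "t \<noteq> 0"
  shows "((\<lambda>s. exp (t * s) * irwin_hall (Suc m) s) has_integral ((exp t - 1) / t) ^ (m + 2))
           {0..real m + 2}"
proof (induction m)
  case 0
  define E1 where "E1 = (\<lambda>s. (s / t - 1 / t\<^sup>2) * exp (t * s))"
  define E2 where "E2 = (\<lambda>s. ((2 - s) / t + 1 / t\<^sup>2) * exp (t * s))"
  have "((\<lambda>s. exp (t * s) * s) has_integral E1 1 - E1 0) {0..1}"
  proof (rule fundamental_theorem_of_calculus)
    fix x show "(E1 has_vector_derivative exp (t * x) * x) (at x within {0..1})"
      unfolding E1_def has_real_derivative_iff_has_vector_derivative[symmetric] using t
      by (auto intro!: derivative_eq_intros simp: field_simps power2_eq_square)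
  qed simp
  then have 1: "((\<lambda>s. exp (t * s) * irwin_hall (Suc 0) s) has_integral E1 1 - E1 0) {0..1}"
    by (rule has_integral_eq[rotated]) (simp add: irwin_hall_1)
  have "((\<lambda>s. exp (t * s) * (2 - s)) has_integral E2 2 - E2 1) {1..2}"
  proof (rule fundamental_theorem_of_calculus)
    fix x show "(E2 has_vector_derivative exp (t * x) * (2 - x)) (at x within {1..2})"
      unfolding E2_def has_real_derivative_iff_has_vector_derivative[symmetric] using t
      by (auto intro!: derivative_eq_intros simp: field_simps power2_eq_square)
  qed simp
  then have 2: "((\<lambda>s. exp (t * s) * irwin_hall (Suc 0) s) has_integral E2 2 - E2 1) {1..2}"
    by (rule has_integral_eq[rotated]) (simp add: irwin_hall_1)
  have "exp (t * 2) = exp t * exp t" by (simp flip: exp_add)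
  then have "(E1 1 - E1 0) + (E2 2 - E2 1) = ((exp t - 1) / t) ^ (0 + 2)"
    unfolding E1_def E2_def using t by (simp add: field_simps power2_eq_square)
  then show ?case using has_integral_combine[OF _ _ 1 2] by simp
next
  case (Suc m)
  define h where "h = irwin_hall (Suc m)"
  define H where "H = irwin_hall (Suc (Suc m))"
  define I where "I = ((exp t - 1) / t) ^ (m + 2)"
  have "((\<lambda>s. exp (t * s) * h s) has_integral I) {0..real m + 2}"
    using Suc unfolding I_def h_def .
  moreover have "((\<lambda>s. exp (t * s) * h s) has_integral 0) {real m + 2..real m + 3}"
    by (rule has_integral_is_0) (simp add: h_def irwin_hall_eq_0_right)
  ultimately have 1: "((\<lambda>s. exp (t * s) * h s) has_integral I) {0..real m + 3}"
    using has_integral_combine[where a = 0 and c = "real m + 2" and b = "real m + 3"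
        and f = "\<lambda>s. exp (t * s) * h s" and i = I and j = 0] by simp
  have "((\<lambda>s. exp (t * (s - 1)) * h (s - 1)) has_integral I) {1..real m + 3}"
    using has_integral_shift_real_ivl[of _ I 0 "real m + 2" "- 1"] Suc
    unfolding I_def h_def by (simp add: add_ac)
  then have "((\<lambda>s. exp t * (exp (t * (s - 1)) * h (s - 1))) has_integral exp t * I) {1..real m + 3}"
    by (rule has_integral_mult_right)
  then have "((\<lambda>s. exp (t * s) * h (s - 1)) has_integral exp t * I) {1..real m + 3}"
    by (simp add: algebra_simps exp_diff)
  moreover have "((\<lambda>s. exp (t * s) * h (s - 1)) has_integral 0) {0..1}"
    by (rule has_integral_is_0) (simp add: h_def irwin_hall_eq_0_left)
  ultimately have 2: "((\<lambda>s. exp (t * s) * h (s - 1)) has_integral exp t * I) {0..real m + 3}"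
    using has_integral_combine[where a = 0 and c = 1 and b = "real m + 3"
        and f = "\<lambda>s. exp (t * s) * h (s - 1)" and i = 0 and j = "exp t * I"] by simp
  define G where "G = (\<lambda>s. exp (t * s) * H s)"
  have "((\<lambda>s. t * (exp (t * s) * H s) + (exp (t * s) * h s - exp (t * s) * h (s - 1)))
      has_integral G (real m + 3) - G 0) {0..real m + 3}"
  proof (rule fundamental_theorem_of_calculus)
    fix s
    have "(H has_real_derivative h s - h (s - 1)) (at s within {0..real m + 3})"
      unfolding H_def h_def by (rule has_field_derivative_at_within[OF DERIV_irwin_hall])
    then show "(G has_vector_derivative t * (exp (t * s) * H s)
        + (exp (t * s) * h s - exp (t * s) * h (s - 1))) (at s within {0..real m + 3})"
      unfolding G_def has_real_derivative_iff_has_vector_derivative[symmetric]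
      by (auto intro!: derivative_eq_intros simp: algebra_simps)
  qed simp
  also have "G (real m + 3) - G 0 = 0"
    unfolding G_def H_def using irwin_hall_eq_0_right[of "Suc m"] by (simp add: irwin_hall_eq_0_left)
  finally have "((\<lambda>s. t * (exp (t * s) * H s)) has_integral 0 - (I - exp t * I)) {0..real m + 3}"
    using has_integral_diff[OF _ has_integral_diff[OF 1 2],
        of "\<lambda>s. t * (exp (t * s) * H s) + (exp (t * s) * h s - exp (t * s) * h (s - 1))" 0]
    by simp
  then have "((\<lambda>s. 1 / t * (t * (exp (t * s) * H s))) has_integral 1 / t * (0 - (I - exp t * I)))
      {0..real m + 3}"
    by (rule has_integral_mult_right)
  moreover have "1 / t * (0 - (I - exp t * I)) = (exp t - 1) / t * I"
    by (simp add: algebra_simps diff_divide_distrib)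
  moreover have "(exp t - 1) / t * I = ((exp t - 1) / t) ^ (Suc m + 2)"
    by (simp add: I_def)
  ultimately show ?case
    using t by (simp add: H_def add.commute)
qed

text \<open>
  Mean and variance of the density proportional to \<open>exp (t s)\<close> on the unit interval. They
  are the first two derivatives of the cumulant generating function of the uniform law at
  \<open>t \<noteq> 0\<close>.
\<close>
definition tilted_mean :: "real \<Rightarrow> real" where
  "tilted_mean t = exp t / (exp t - 1) - 1 / t"

definition tilted_var :: "real \<Rightarrow> real" where
  "tilted_var t = 1 / t\<^sup>2 - exp t / (exp t - 1)\<^sup>2"

lemma DERIV_uniform_mgf:
  assumes "t \<noteq> (0::real)"
  shows "((\<lambda>t. (exp t - 1) / t) has_real_derivative tilted_mean t * ((exp t - 1) / t)) (at t)"
  using assms unfolding tilted_mean_def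
  by (auto intro!: derivative_eq_intros simp: divide_simps)

lemma DERIV_tilted_mean:
  assumes "0 < t"
  shows "(tilted_mean has_real_derivative tilted_var t) (at t)"
proof -
  have "(tilted_mean has_real_derivative
      (exp t * (exp t - 1) - exp t * exp t) / ((exp t - 1) * (exp t - 1)) - (0 * t - 1 * 1) / (t * t)) (at t)"
    unfolding tilted_mean_def[abs_def] using assms
    by (intro DERIV_diff DERIV_divide) (auto intro!: derivative_eq_intros)
  also have "exp t * (exp t - 1) - exp t * exp t = - exp t"
    by (simp add: algebra_simps)
  finally show ?thesis
    by (simp add: tilted_var_def power2_eq_square)
qed

text \<open>
  This is \<open>t < 2 sinh (t / 2)\<close>, which is what positivity of the tilted variance amounts to.
\<close>
lemma mult_exp_half_less_exp_minus_1:
  fixes t :: real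
  assumes "0 < t"
  shows "t * exp (t / 2) < exp t - 1"
proof -
  have "(\<lambda>t::real. exp t - 1 - t * exp (t / 2)) 0 < (\<lambda>t. exp t - 1 - t * exp (t / 2)) t"
  proof (rule DERIV_pos_imp_increasing_open[OF assms])
    fix u :: real assume u: "0 < u" "u < t"
    have "((\<lambda>t::real. exp t - 1 - t * exp (t / 2)) has_real_derivative
        exp u - (exp (u / 2) + exp (u / 2) * (1 / 2) * u)) (at u)"
      by (auto intro!: derivative_eq_intros)
    moreover have "exp u = exp (u / 2) * exp (u / 2)" by (simp flip: exp_add)
    then have "exp u - (exp (u / 2) + exp (u / 2) * (1 / 2) * u) = exp (u / 2) * (exp (u / 2) - (1 + u / 2))"
      by (simp add: algebra_simps)
    moreover have "\<dots> > 0" using exp_minus_greater[of "- (u / 2)"] u by simp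
    ultimately show "\<exists>y. ((\<lambda>t::real. exp t - 1 - t * exp (t / 2)) has_real_derivative y) (at u) \<and> y > 0"
      by metis
  qed (intro continuous_intros; simp)
  then show ?thesis by simp
qed

lemma tilted_var_pos:
  assumes "0 < t"
  shows "0 < tilted_var t"
proof -
  have "(t * exp (t / 2))\<^sup>2 < (exp t - 1)\<^sup>2"
    using mult_exp_half_less_exp_minus_1[OF assms] assms by (intro power_strict_mono) auto
  moreover have "(exp (t / 2))\<^sup>2 = exp t" by (simp flip: exp_add add: power2_eq_square)
  ultimately have "t\<^sup>2 * exp t < (exp t - 1)\<^sup>2" by (simp add: power_mult_distrib)
  then show ?thesis using assms by (simp add: tilted_var_def field_simps)
qed

lemma DERIV_moment:
  fixes g :: "real \<Rightarrow> real"
  assumes cont: "continuous_on {0..b} g"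
  shows "((\<lambda>t. integral {0..b} (\<lambda>s. s ^ k * exp (t * s) * g s)) has_real_derivative
           integral {0..b} (\<lambda>s. s ^ Suc k * exp (t * s) * g s)) (at t)"
proof -
  have "((\<lambda>t. integral (cbox 0 b) (\<lambda>s. s ^ k * exp (t * s) * g s)) has_real_derivative
           integral (cbox 0 b) (\<lambda>s. s ^ Suc k * exp (t * s) * g s)) (at t within UNIV)"
  proof (rule leibniz_rule_field_derivative)
    show "((\<lambda>t. s ^ k * exp (t * s) * g s) has_real_derivative s ^ Suc k * exp (t * s) * g s) (at t within UNIV)"
      for t s by (auto intro!: derivative_eq_intros)
    show "(\<lambda>s. s ^ k * exp (t * s) * g s) integrable_on cbox 0 b" for t
      using cont by (intro integrable_continuous continuous_intros) auto
    have "continuous_on (UNIV \<times> {0..b}) (\<lambda>z. g (snd z))"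
      by (rule continuous_on_compose2[OF cont]) (auto intro!: continuous_intros)
    then show "continuous_on (UNIV \<times> cbox 0 b) (\<lambda>(t, s). s ^ Suc k * exp (t * s) * g s)"
      unfolding case_prod_beta by (intro continuous_intros) auto
  qed auto
  then show ?thesis by simp
qed

text \<open>
  The moment generating function \<open>F 0\<close> of the sum is the power of that of a single
  variable. Differentiating it twice, once under the integral sign and once in closed form,
  identifies the first two moments under the tilted density: mean \<open>n\<close> times
  \<open>tilted_mean t\<close> and variance \<open>n\<close> times \<open>tilted_var t\<close>, where
  \<open>n = m + 2\<close>. The second moment about \<open>c\<close> exceeds the variance by the square
  of the distance from \<open>c\<close> to the mean.
\<close>
lemma irwin_hall_tilted_variance_ge:
  assumes t: "0 < t"
  shows "(real m + 2) * tilted_var t * ((exp t - 1) / t) ^ (m + 2)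
    \<le> integral {0..real m + 2} (\<lambda>s. (s - c)\<^sup>2 * (exp (t * s) * irwin_hall (Suc m) s))"
proof -
  define b where "b = real m + 2"
  define h where "h = irwin_hall (Suc m)"
  have ch: "continuous_on A h" for A unfolding h_def by (rule continuous_irwin_hall)
  define F where "F = (\<lambda>k t. integral {0..b} (\<lambda>s. s ^ k * exp (t * s) * h s))"
  have dF: "(F k has_real_derivative F (Suc k) u) (at u)" for k u
    unfolding F_def by (rule DERIV_moment[OF ch])
  have F0: "F 0 u = ((exp u - 1) / u) ^ (m + 2)" if "0 < u" for u
    using irwin_hall_mgf[of u m] that unfolding F_def h_def b_def by (auto dest: integral_unique)
  have F1: "F 1 u = b * tilted_mean u * F 0 u" if u: "0 < u" for u
  proof -
    have "((\<lambda>u. ((exp u - 1) / u) ^ (m + 2)) has_real_derivative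
        real (m + 2) * (tilted_mean u * ((exp u - 1) / u) * ((exp u - 1) / u) ^ (m + 2 - Suc 0))) (at u)"
      using u by (intro DERIV_power[OF DERIV_uniform_mgf]) simp
    then have "((\<lambda>u. ((exp u - 1) / u) ^ (m + 2)) has_real_derivative b * tilted_mean u * F 0 u) (at u)"
      unfolding F0[OF u] b_def by (simp add: mult_ac add_ac)
    then have "(F 0 has_real_derivative b * tilted_mean u * F 0 u) (at u)"
      by (rule has_field_derivative_transform_within_open[of _ _ _ "{0<..}"]) (use u F0 in auto)
    then show ?thesis using dF[of 0 u] DERIV_unique by fastforce
  qed
  have F2: "F 2 t = b * tilted_var t * F 0 t + b * tilted_mean t * F 1 t"
  proof -
    have "((\<lambda>u. b * tilted_mean u * F 0 u) has_real_derivative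
        b * tilted_var t * F 0 t + F 1 t * (b * tilted_mean t)) (at t)"
      using DERIV_mult[OF DERIV_cmult[OF DERIV_tilted_mean[OF t], of b] dF[of 0 t]] by simp
    then have "(F 1 has_real_derivative b * tilted_var t * F 0 t + F 1 t * (b * tilted_mean t)) (at t)"
      by (rule has_field_derivative_transform_within_open[of _ _ _ "{0<..}"]) (use t F1 in auto)
    moreover have "(F 1 has_real_derivative F 2 t) (at t)"
      using dF[of 1 t] by (simp add: numeral_2_eq_2)
    ultimately show ?thesis using DERIV_unique by fastforce
  qed
  have int: "(\<lambda>s. s ^ k * exp (t * s) * h s) integrable_on {0..b}" for k
    by (intro integrable_continuous_real continuous_intros ch)
  have "integral {0..b} (\<lambda>s. (s - c)\<^sup>2 * (exp (t * s) * h s))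
      = integral {0..b} (\<lambda>s. s ^ 2 * exp (t * s) * h s - 2 * c * (s ^ 1 * exp (t * s) * h s)
           + c\<^sup>2 * (s ^ 0 * exp (t * s) * h s))"
    by (rule arg_cong[of _ _ "integral _"], rule ext) (simp add: power2_eq_square algebra_simps)
  also have "\<dots> = F 2 t - 2 * c * F 1 t + c\<^sup>2 * F 0 t"
    unfolding F_def
    by (intro integral_unique has_integral_add has_integral_diff has_integral_mult_right
        integrable_integral int)
  also have "\<dots> = b * tilted_var t * F 0 t + (b * tilted_mean t - c)\<^sup>2 * F 0 t"
    unfolding F2 F1[OF t] by (simp add: power2_eq_square algebra_simps)
  also have "\<dots> \<ge> b * tilted_var t * F 0 t"
    using F0[OF t] t by simp
  finally show ?thesis unfolding F0[OF t] h_def b_def .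
qed

text \<open>
  The factor \<open>exp (t s)\<close> preserves log-concavity, so the general bound on the maximum of a
  density by its variance applies to the tilted density. This supplies the factor
  \<open>1 / sqrt n\<close> of the final estimate.
\<close>
lemma irwin_hall_tilted_le:
  assumes t: "0 < t"
  shows "exp (t * s) * irwin_hall (Suc m) s
    \<le> sqrt (2 / ((real m + 2) * tilted_var t)) * ((exp t - 1) / t) ^ (m + 2)"
proof (cases "0 \<le> s \<and> s \<le> real m + 2")
  case False
  then have "irwin_hall (Suc m) s = 0"
    using irwin_hall_eq_0_left[of s] irwin_hall_eq_0_right[of m s] by (cases "s < 0") auto
  moreover have "0 \<le> sqrt (2 / ((real m + 2) * tilted_var t)) * ((exp t - 1) / t) ^ (m + 2)"
    using t tilted_var_pos[OF t] by (intro mult_nonneg_nonneg real_sqrt_ge_zero zero_le_power) auto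
  ultimately show ?thesis by (simp only: mult_zero_right)
next
  case True
  define f where "f = (\<lambda>s. exp (t * s) * irwin_hall (Suc m) s)"
  define M where "M = ((exp t - 1) / t) ^ (m + 2)"
  define V where "V = (real m + 2) * tilted_var t"
  have M: "0 < M" unfolding M_def using t by simp
  have V: "0 < V" unfolding V_def using tilted_var_pos[OF t] by (simp add: add_pos_pos)
  have "(f s)\<^sup>2 * (V * M) \<le> (f s)\<^sup>2 * integral {0..real m + 2} (\<lambda>u. (u - s)\<^sup>2 * f u)"
    using irwin_hall_tilted_variance_ge[OF t, of m s] unfolding f_def V_def M_def
    by (intro mult_left_mono) auto
  also have "\<dots> \<le> 2 * (integral {0..real m + 2} f) ^ 3"
  proof (rule log_concave_sup_sq_variance_le)
    show "f x * f (y + d) \<le> f (x + d) * f y" if "x \<le> y" "0 \<le> d" for x y d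
    proof -
      have "exp (t * (x + y + d)) * (irwin_hall (Suc m) x * irwin_hall (Suc m) (y + d))
          \<le> exp (t * (x + y + d)) * (irwin_hall (Suc m) (x + d) * irwin_hall (Suc m) y)"
        by (intro mult_left_mono irwin_hall_log_concave that) simp
      then show ?thesis unfolding f_def by (simp add: exp_add distrib_left mult_ac)
    qed
  qed (use True in \<open>auto simp: f_def irwin_hall_nonneg irwin_hall_eq_0_left irwin_hall_eq_0_right
        intro!: continuous_intros continuous_irwin_hall\<close>)
  also have "integral {0..real m + 2} f = M"
    unfolding f_def M_def using irwin_hall_mgf[of t m] t by (auto dest: integral_unique)
  finally have "(f s)\<^sup>2 \<le> (2 / V) * M\<^sup>2"
    using M V by (simp add: field_simps power2_eq_square power3_eq_cube)
  then have "f s \<le> sqrt ((2 / V) * M\<^sup>2)" by (rule real_le_rsqrt)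
  also have "sqrt ((2 / V) * M\<^sup>2) = sqrt (2 / V) * M"
    using M by (simp only: real_sqrt_mult real_sqrt_abs abs_of_pos)
  finally show ?thesis unfolding f_def M_def V_def .
qed

text \<open>
  Undoing the tilt, the density is at most a constant times \<open>exp (- t s)\<close>, and this is
  integrated from \<open>a\<close> on. The comparison is made on derivatives, starting from the right
  end of the support, where the tail is zero.
\<close>
lemma irwin_hall_tail_le:
  assumes t: "0 < t" and a: "0 \<le> a"
  shows "irwin_hall_tail m a
    \<le> sqrt (2 / ((real m + 2) * tilted_var t)) * ((exp t - 1) / t) ^ (m + 2) * exp (- t * a) / t"
proof (cases "a \<le> real m + 2")
  case False
  then show ?thesis using irwin_hall_tail_eq_0[of m a] t tilted_var_pos[OF t] by simp
next
  case True
  define B where "B = sqrt (2 / ((real m + 2) * tilted_var t)) * ((exp t - 1) / t) ^ (m + 2)"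
  define g where "g = (\<lambda>s. B * exp (- t * s) / t - irwin_hall_tail m s)"
  have "0 \<le> B" unfolding B_def using t tilted_var_pos[OF t] by simp
  then have "0 \<le> g (real m + 2)" unfolding g_def using irwin_hall_tail_eq_0[of m] t by simp
  also have "\<dots> \<le> g a"
  proof (rule DERIV_nonpos_imp_nonincreasing[OF True])
    fix s assume s: "a \<le> s" "s \<le> real m + 2"
    have "(g has_real_derivative B * (exp (- t * s) * - t) / t - - irwin_hall (Suc m) s) (at s)"
      unfolding g_def using s a
      by (intro DERIV_diff DERIV_irwin_hall_tail) (auto intro!: derivative_eq_intros)
    moreover have "irwin_hall (Suc m) s \<le> B * exp (- t * s)"
    proof -
      have "exp (t * s) * irwin_hall (Suc m) s \<le> B"
        using irwin_hall_tilted_le[OF t, of s m] unfolding B_def .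
      then show ?thesis by (simp add: exp_minus field_simps)
    qed
    ultimately show "\<exists>y. (g has_real_derivative y) (at s) \<and> y \<le> 0"
      using t by (intro exI conjI) auto
  qed
  finally show ?thesis unfolding g_def B_def by simp
qed

section \<open>The limiting cumulant generating function\<close>
lemma limit_cgf_eq: "t \<noteq> 0 \<Longrightarrow> limit_cgf t = ln ((exp t - 1) / t)"
  by (simp add: limit_cgf_def)

lemma uniform_mgf_pos: "t \<noteq> 0 \<Longrightarrow> 0 < (exp t - 1) / (t::real)"
  by (cases "0 < t") (auto simp: divide_neg_neg)

lemma DERIV_limit_cgf:
  assumes "t \<noteq> 0"
  shows "(limit_cgf has_real_derivative tilted_mean t) (at t)"
proof -
  have "((\<lambda>t. ln ((exp t - 1) / t)) has_real_derivative
      1 / ((exp t - 1) / t) * (tilted_mean t * ((exp t - 1) / t))) (at t)"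
    using assms by (intro DERIV_chain2[OF DERIV_ln_divide DERIV_uniform_mgf] uniform_mgf_pos)
  also have "1 / ((exp t - 1) / t) * (tilted_mean t * ((exp t - 1) / t)) = tilted_mean t"
    using uniform_mgf_pos[OF assms] assms by simp
  finally show ?thesis
    by (rule has_field_derivative_transform_within_open[of _ _ _ "- {0}"])
       (use assms in \<open>auto simp: limit_cgf_eq\<close>)
qed

lemma DERIV_limit_cgf_0: "(limit_cgf has_real_derivative 1 / 2) (at 0)"
proof -
  have "((\<lambda>t::real. ln ((exp t - 1) / t) / t) \<longlongrightarrow> 1 / 2) (at 0)"
    by real_asymp
  also have "?this \<longleftrightarrow> ((\<lambda>t. (limit_cgf (0 + t) - limit_cgf 0) / t) \<longlongrightarrow> 1 / 2) (at 0)"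
    by (rule tendsto_cong) (auto simp: limit_cgf_def eventually_at_filter)
  finally show ?thesis unfolding DERIV_def .
qed

text \<open>
  Together with \<open>tilted_mean (- t) = 1 - tilted_mean t\<close> this shows that the derivative of
  \<open>limit_cgf\<close> is at most \<open>1 / 2\<close> on the left half-line, so only positive
  arguments can give a derivative \<open>x > 1 / 2\<close>.
\<close>
lemma tilted_mean_gt_half:
  assumes "0 < t"
  shows "1 / 2 < tilted_mean t"
proof -
  have "(\<lambda>t::real. t * (exp t + 1) - 2 * (exp t - 1)) 0 < (\<lambda>t. t * (exp t + 1) - 2 * (exp t - 1)) t"
  proof (rule DERIV_pos_imp_increasing_open[OF assms])
    fix u :: real assume u: "0 < u" "u < t"
    have "((\<lambda>t::real. t * (exp t + 1) - 2 * (exp t - 1)) has_real_derivative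
        exp u * (exp (- u) - (1 + - u))) (at u)"
      by (auto intro!: derivative_eq_intros simp: exp_minus field_simps)
    moreover have "exp (- u) - (1 + - u) > 0"
      using exp_minus_greater[of u] u by simp
    ultimately show "\<exists>y. ((\<lambda>t::real. t * (exp t + 1) - 2 * (exp t - 1)) has_real_derivative y) (at u) \<and> y > 0"
      by (intro exI conjI) auto
  qed (intro continuous_intros)
  then show ?thesis using assms by (simp add: tilted_mean_def field_simps)
qed

lemma tilted_mean_minus:
  assumes "t \<noteq> 0"
  shows "tilted_mean (- t) = 1 - tilted_mean t"
  using assms by (simp add: tilted_mean_def exp_minus divide_simps) (simp add: algebra_simps)

lemma tilted_mean_less:
  assumes "0 < s" "s < t"
  shows "tilted_mean s < tilted_mean t"
  using assms(2)
  by (rule DERIV_pos_imp_increasing)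
     (use assms in \<open>auto intro!: exI[of _ "tilted_var _"] DERIV_tilted_mean tilted_var_pos\<close>)

lemma tilted_mean_surj:
  assumes "1 / 2 < x" "x < 1"
  obtains t where "0 < t" "tilted_mean t = x"
proof -
  have "((\<lambda>t::real. exp t / (exp t - 1) - 1 / t) \<longlongrightarrow> 1 / 2) (at_right 0)"
    by real_asymp
  then have "\<forall>\<^sub>F t in at_right 0. tilted_mean t < x"
    unfolding tilted_mean_def using assms(1) by (rule order_tendstoD)
  then obtain e :: real where e: "0 < e" "\<And>t. 0 < t \<Longrightarrow> t < e \<Longrightarrow> tilted_mean t < x"
    unfolding eventually_at_right_field by blast
  \<comment> \<open>Since \<open>tilted_mean t > 1 - 1 / t\<close>, the point \<open>1 / (1 - x)\<close> is far
      enough to the right.\<close>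
  define b where "b = 1 / (1 - x)"
  define a where "a = min (e / 2) b"
  have b: "0 < b" using assms by (simp add: b_def)
  have a: "0 < a" "a \<le> b" "tilted_mean a < x" unfolding a_def using b e by auto
  have "1 / b = 1 - x" by (simp add: b_def)
  moreover have "1 < exp b / (exp b - 1)" using b by (simp add: field_simps)
  ultimately have xb: "x \<le> tilted_mean b" by (simp add: tilted_mean_def)
  have "continuous_on {a..b} tilted_mean"
    using a by (intro DERIV_continuous_on[OF has_field_derivative_at_within[OF DERIV_tilted_mean]]) auto
  with a xb obtain t where "a \<le> t" "t \<le> b" "tilted_mean t = x"
    using IVT'[of tilted_mean a x b] by auto
  with a that[of t] show thesis by auto
qed

lemma deriv_limit_cgf: "deriv limit_cgf t = (if t = 0 then 1 / 2 else tilted_mean t)"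
  using DERIV_imp_deriv[OF DERIV_limit_cgf[of t]] DERIV_imp_deriv[OF DERIV_limit_cgf_0] by simp

lemma tilt_eq:
  assumes "1 / 2 < x" "x < 1"
  shows "0 < tilt x" "tilted_mean (tilt x) = x"
proof -
  obtain t where t: "0 < t" "tilted_mean t = x" using tilted_mean_surj[OF assms] .
  have "tilt x = t"
    unfolding tilt_def
  proof (rule the_equality)
    show "deriv limit_cgf t = x" using t by (simp add: deriv_limit_cgf)
    fix s assume s: "deriv limit_cgf s = x"
    have "0 < s"
    proof (rule ccontr)
      assume "\<not> 0 < s"
      then have "deriv limit_cgf s \<le> 1 / 2"
        using tilted_mean_gt_half[of "- s"] tilted_mean_minus[of s] by (auto simp: deriv_limit_cgf)
      with s assms show False by simp
    qed
    with s have "tilted_mean s = tilted_mean t" using t by (simp add: deriv_limit_cgf)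
    then show "s = t"
      using tilted_mean_less[of s t] tilted_mean_less[of t s] t \<open>0 < s\<close> by linarith
  qed
  with t show "0 < tilt x" "tilted_mean (tilt x) = x" by auto
qed

lemma tilt_sd_eq:
  assumes "1 / 2 < x" "x < 1"
  shows "tilt_sd x = sqrt (tilted_var (tilt x))"
proof -
  have "(deriv limit_cgf has_real_derivative tilted_var (tilt x)) (at (tilt x))"
    by (rule has_field_derivative_transform_within_open[OF DERIV_tilted_mean[OF tilt_eq(1)[OF assms]],
          of "{0<..}"])
       (use tilt_eq(1)[OF assms] in \<open>auto simp: deriv_limit_cgf\<close>)
  then show ?thesis by (simp add: tilt_sd_def DERIV_imp_deriv)
qed

text \<open>
  The function \<open>s \<mapsto> x s - limit_cgf s\<close> increases up to \<open>tilt x\<close> and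
  decreases afterwards, because the derivative of \<open>limit_cgf\<close> is below \<open>x\<close> to
  the left of \<open>tilt x\<close> and above it to the right. An upper bound for the rate is the
  useful direction, as the claimed estimate decreases in the rate.
\<close>
lemma rate_fun_le:
  assumes "1 / 2 < x" "x < 1"
  shows "rate_fun x \<le> x * tilt x - limit_cgf (tilt x)"
  unfolding rate_fun_def
proof (rule cSUP_least)
  fix s
  define t where "t = tilt x"
  have t: "0 < t" "tilted_mean t = x" using tilt_eq[OF assms] by (auto simp: t_def)
  define g where "g = (\<lambda>s. x * s - limit_cgf s)"
  have dg: "(g has_real_derivative x - deriv limit_cgf u) (at u)" for u
    unfolding g_def using DERIV_limit_cgf[of u] DERIV_limit_cgf_0
    by (auto intro!: derivative_eq_intros simp: deriv_limit_cgf)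
  have "g s \<le> g t"
  proof (cases "s \<le> t")
    case True
    then show ?thesis
    proof (rule DERIV_nonneg_imp_nondecreasing)
      fix u assume u: "s \<le> u" "u \<le> t"
      have "deriv limit_cgf u \<le> x"
        using tilted_mean_gt_half[of "- u"] tilted_mean_minus[of u] assms tilted_mean_less[of u t] t u
        by (cases "u = t"; cases "u = 0"; cases "0 < u") (auto simp: deriv_limit_cgf)
      with dg[of u] show "\<exists>y. (g has_real_derivative y) (at u) \<and> 0 \<le> y" by auto
    qed
  next
    case False
    then have "t \<le> s" by simp
    then show ?thesis
    proof (rule DERIV_nonpos_imp_nonincreasing)
      fix u assume u: "t \<le> u" "u \<le> s"
      then have "x \<le> deriv limit_cgf u"
        using tilted_mean_less[of t u] t by (cases "u = t") (auto simp: deriv_limit_cgf)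
      with dg[of u] show "\<exists>y. (g has_real_derivative y) (at u) \<and> y \<le> 0" by auto
    qed
  qed
  then show "x * s - limit_cgf s \<le> x * tilt x - limit_cgf (tilt x)" by (simp add: g_def t_def)
qed simp

section \<open>Descents and sums of uniform variables\<close>

text \<open>
  Inserting a new maximum is a simple operation on one-line notations, but an awkward one on
  permutations as functions. This is why descents are counted on lists.
\<close>
definition list_descents :: "nat list \<Rightarrow> nat" where
  "list_descents xs = (\<Sum>k<length xs - 1. of_bool (xs ! Suc k < xs ! k))"

lemma list_descents_simps [simp]:
  "list_descents [] = 0" "list_descents [x] = 0"
  "list_descents (x # y # zs) = of_bool (y < x) + list_descents (y # zs)"
  by (simp_all add: list_descents_def sum.lessThan_Suc_shift del: sum.lessThan_Suc)

lemma list_descents_map: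
  "list_descents (map p [1..<Suc n]) = descents n p"
proof -
  have "list_descents (map p [1..<Suc n]) = (\<Sum>k<n - 1. of_bool (p (Suc (Suc k)) < p (Suc k)))"
    by (auto simp: list_descents_def simp del: upt_Suc intro!: sum.cong)
  also have "\<dots> = (\<Sum>k\<in>{1..n - 1}. of_bool (p (Suc k) < p k))"
    by (rule sum.reindex_bij_witness[of _ "\<lambda>k. k - 1" Suc]) auto
  also have "\<dots> = descents n p"
    unfolding descents_def by (simp add: sum_of_bool_eq Int_def conj_commute)
  finally show ?thesis .
qed

definition insert_at :: "nat \<Rightarrow> nat \<Rightarrow> nat list \<Rightarrow> nat list" where
  "insert_at m i xs = take i xs @ m # drop i xs"

lemma insert_at_simps [simp]:
  "insert_at m 0 xs = m # xs" "insert_at m (Suc i) (x # xs) = x # insert_at m i xs"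
  by (simp_all add: insert_at_def)

text \<open>
  A new maximum creates a descent unless it is appended at the end or placed inside an existing
  descent. So among the \<open>length xs + 1\<close> positions, \<open>list_descents xs + 1\<close> keep
  the number of descents and the others raise it by one. The statement sums a test function, so that
  in the induction the contribution of the first two entries can be absorbed into that function.
\<close>
lemma sum_list_descents_insert_at:
  fixes g :: "nat \<Rightarrow> real"
  assumes "xs \<noteq> []" "\<forall>x\<in>set xs. x < m"
  shows "(\<Sum>i\<le>length xs. g (list_descents (insert_at m i xs)))
    = (real (list_descents xs) + 1) * g (list_descents xs)
      + (real (length xs) - real (list_descents xs)) * g (list_descents xs + 1)"
  using assms
proof (induction xs arbitrary: g rule: induct_list012)
  case (2 x)
  then show ?case by simp
next
  case (3 x y zs)
  define d where "d = list_descents (y # zs)"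
  define g' where "g' = (\<lambda>k. g (of_bool (y < x) + k))"
  have IH: "(\<Sum>i\<le>length (y # zs). g' (list_descents (insert_at m i (y # zs))))
    = (real d + 1) * g' d + (real (length (y # zs)) - real d) * g' (d + 1)"
    using "3.IH"(2)[of g'] "3.prems" by (simp add: d_def)
  have "(\<Sum>i\<le>length zs. g' (list_descents (y # insert_at m i zs)))
     = (real d + 1) * g' d + (real (length zs) - real d) * g' (d + 1)"
    using IH "3.prems" by (simp add: sum.atMost_Suc_shift d_def algebra_simps del: sum.atMost_Suc)
  moreover have "(\<Sum>i\<le>length (x # y # zs). g (list_descents (insert_at m i (x # y # zs))))
      = g (1 + (of_bool (y < x) + d)) + (g (1 + d)
        + (\<Sum>i\<le>length zs. g' (list_descents (y # insert_at m i zs))))"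
    using "3.prems" by (simp add: sum.atMost_Suc_shift d_def g'_def del: sum.atMost_Suc)
  ultimately show ?case
    by (simp add: g'_def flip: d_def) (auto simp: algebra_simps)
qed simp

lemma permutations_of_set_Suc:
  "bij_betw (\<lambda>(xs, i). insert_at (Suc n) i xs)
     (permutations_of_set {1..n} \<times> {..n}) (permutations_of_set {1..Suc n})"
proof -
  let ?f = "\<lambda>(xs, i). insert_at (Suc n) i xs"
  let ?A = "permutations_of_set {1..n} \<times> {..n}"
  have inj: "inj_on ?f ?A"
  proof (rule inj_onI, clarify)
    fix xs ys i j
    assume xs: "xs \<in> permutations_of_set {1..n}" "i \<le> n" and ys: "ys \<in> permutations_of_set {1..n}" "j \<le> n"
      and eq: "insert_at (Suc n) i xs = insert_at (Suc n) j ys"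
    have nin: "Suc n \<notin> set xs" "Suc n \<notin> set ys"
      and len: "length xs = n" "length ys = n"
      using xs ys by (auto simp: permutations_of_set_def distinct_card dest!: distinct_card)
    have "Suc n \<notin> set (take i xs)" "Suc n \<notin> set (drop i xs)"
      using nin by (auto dest: in_set_takeD in_set_dropD)
    then have "take i xs = take j ys \<and> drop i xs = drop j ys"
      using eq unfolding insert_at_def by (simp only: append_Cons_eq_iff simp_thms)
    then show "xs = ys \<and> i = j"
      using xs ys len by (metis append_take_drop_id length_take min.absorb2)
  qed
  moreover have "?f ` ?A = permutations_of_set {1..Suc n}"
  proof (rule card_subset_eq)
    show "?f ` ?A \<subseteq> permutations_of_set {1..Suc n}"
    proof
      fix zs assume "zs \<in> ?f ` ?A"
      then obtain xs i where xs: "xs \<in> permutations_of_set {1..n}" and zs: "zs = insert_at (Suc n) i xs"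
        by auto
      have s: "set xs = {1..n}" "distinct xs" using permutations_of_setD[OF xs] by simp_all
      have "set (insert_at (Suc n) i xs) = insert (Suc n) (set (take i xs @ drop i xs))"
        by (auto simp: insert_at_def simp del: append_take_drop_id)
      also have "\<dots> = {1..Suc n}" unfolding append_take_drop_id s by (simp add: atLeastAtMostSuc_conv)
      finally have "set (insert_at (Suc n) i xs) = {1..Suc n}" .
      moreover have "distinct (take i xs @ drop i xs)" "Suc n \<notin> set (take i xs @ drop i xs)"
        unfolding append_take_drop_id s using s by simp_all
      then have "distinct (insert_at (Suc n) i xs)"
        by (auto simp: insert_at_def simp del: append_take_drop_id)
      ultimately show "zs \<in> permutations_of_set {1..Suc n}"
        unfolding zs by (rule permutations_of_setI)
    qed
    show "card (?f ` ?A) = card (permutations_of_set {1..Suc n})"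
      unfolding card_image[OF inj] by (simp add: card_cartesian_product)
  qed simp
  ultimately show ?thesis by (simp add: bij_betw_def)
qed

text \<open>
  The number of descents equals \<open>k\<close> with probability \<open>irwin_hall n (k + 1)\<close>: at
  integer points the insertion of the maximum and the recurrence of the splines are the same
  recurrence. By the derivative formula this probability is also that of the sum of
  \<open>n\<close> uniform variables lying between \<open>k\<close> and \<open>k + 1\<close>.
\<close>
lemma sum_list_descents_eq_irwin_hall:
  fixes g :: "nat \<Rightarrow> real"
  shows "(\<Sum>xs\<in>permutations_of_set {1..n}. g (list_descents xs))
           = fact n * (\<Sum>k\<le>n. irwin_hall n (real k + 1) * g k)"
proof (induction n arbitrary: g)
  case 0
  then show ?case by simp
next
  case (Suc n)
  have "(\<Sum>xs\<in>permutations_of_set {1..Suc n}. g (list_descents xs))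
      = (\<Sum>xs\<in>permutations_of_set {1..n}. \<Sum>i\<le>n. g (list_descents (insert_at (Suc n) i xs)))"
    unfolding sum.reindex_bij_betw[OF permutations_of_set_Suc, symmetric]
    by (simp add: sum.cartesian_product case_prod_beta)
  also have "\<dots> = (\<Sum>xs\<in>permutations_of_set {1..n}.
      (\<lambda>d. (real d + 1) * g d + (real n - real d) * g (d + 1)) (list_descents xs))"
  proof (rule sum.cong[OF refl])
    fix xs assume "xs \<in> permutations_of_set {1..n}"
    then have xs: "set xs = {1..n}" "length xs = n"
      by (auto simp: permutations_of_set_def dest: distinct_card)
    show "(\<Sum>i\<le>n. g (list_descents (insert_at (Suc n) i xs)))
        = (\<lambda>d. (real d + 1) * g d + (real n - real d) * g (d + 1)) (list_descents xs)"
    proof (cases "xs = []")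
      case True
      with xs have "n = 0" by simp
      with True show ?thesis by simp
    next
      case False
      then show ?thesis using sum_list_descents_insert_at[of xs "Suc n" g] xs by auto
    qed
  qed
  also have "\<dots> = fact n * (\<Sum>k\<le>n. irwin_hall n (real k + 1)
      * ((real k + 1) * g k + (real n - real k) * g (k + 1)))"
    by (rule Suc)
  also have "(\<Sum>k\<le>n. irwin_hall n (real k + 1) * ((real k + 1) * g k + (real n - real k) * g (k + 1)))
      = (\<Sum>k\<le>n. (real k + 1) * irwin_hall n (real k + 1) * g k)
        + (\<Sum>k\<le>n. (real n - real k) * irwin_hall n (real k + 1) * g (k + 1))"
    unfolding sum.distrib[symmetric] by (intro sum.cong refl) (simp add: algebra_simps)
  also have "(\<Sum>k\<le>n. (real k + 1) * irwin_hall n (real k + 1) * g k)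
      = (\<Sum>k\<le>Suc n. (real k + 1) * irwin_hall n (real k + 1) * g k)"
    using irwin_hall_eq_0_right_strict[of n "real n + 2"] by (simp add: add_ac)
  also have "(\<Sum>k\<le>n. (real n - real k) * irwin_hall n (real k + 1) * g (k + 1))
      = (\<Sum>k\<le>Suc n. (real n + 1 - real k) * irwin_hall n (real k) * g k)"
    by (subst sum.atMost_Suc_shift) (simp add: irwin_hall_eq_0_left add_ac)
  also have "(\<Sum>k\<le>Suc n. (real k + 1) * irwin_hall n (real k + 1) * g k) + \<dots>
      = (real n + 1) * (\<Sum>k\<le>Suc n. irwin_hall (Suc n) (real k + 1) * g k)"
    unfolding sum.distrib[symmetric] sum_distrib_left
  proof (rule sum.cong[OF refl])
    fix k
    have "real n + 2 - (real k + 1) = real n + 1 - real k" by simp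
    then have "(real n + 1) * irwin_hall (Suc n) (real k + 1)
        = (real k + 1) * irwin_hall n (real k + 1) + (real n + 1 - real k) * irwin_hall n (real k)"
      unfolding irwin_hall.simps(2) by simp
    then show "(real k + 1) * irwin_hall n (real k + 1) * g k + (real n + 1 - real k) * irwin_hall n (real k) * g k
        = (real n + 1) * (irwin_hall (Suc n) (real k + 1) * g k)"
      by (metis distrib_right mult.assoc)
  qed
  finally show ?case by (simp add: add_ac mult_ac)
qed

lemma permutes_bij_betw_permutations_of_set:
  "bij_betw (\<lambda>p. map p [1..<Suc n]) {p. p permutes {1..n}} (permutations_of_set {1..n})"
proof -
  have inj: "inj_on (\<lambda>p. map p [1..<Suc n]) {p. p permutes {1..n}}"
  proof (rule inj_onI, clarify)
    fix p q assume pq: "p permutes {1..n}" "q permutes {1..n}" "map p [1..<Suc n] = map q [1..<Suc n]"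
    show "p = q"
    proof
      fix k show "p k = q k"
        using pq by (cases "k \<in> {1..n}") (auto simp: permutes_not_in simp del: upt_Suc)
    qed
  qed
  moreover have "(\<lambda>p. map p [1..<Suc n]) ` {p. p permutes {1..n}} = permutations_of_set {1..n}"
  proof (rule card_subset_eq)
    show "(\<lambda>p. map p [1..<Suc n]) ` {p. p permutes {1..n}} \<subseteq> permutations_of_set {1..n}"
    proof clarify
      fix p assume p: "p permutes {1..n}"
      have "set (map p [1..<Suc n]) = p ` {1..n}" by (simp add: atLeastLessThanSuc_atLeastAtMost del: upt_Suc)
      also have "\<dots> = {1..n}" using p by (rule permutes_image)
      finally show "map p [1..<Suc n] \<in> permutations_of_set {1..n}"
        using permutes_inj_on[OF p] by (auto simp: permutations_of_set_def distinct_map simp del: upt_Suc)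
    qed
    show "card ((\<lambda>p. map p [1..<Suc n]) ` {p. p permutes {1..n}}) = card (permutations_of_set {1..n})"
      unfolding card_image[OF inj] by (simp add: card_permutations[OF refl])
  qed simp
  ultimately show ?thesis by (simp add: bij_betw_def)
qed

lemma prob_descents_eq:
  "measure_pmf.prob (random_perm n) {p. P (descents n p)}
     = (\<Sum>k\<le>n. irwin_hall n (real k + 1) * of_bool (P k))"
proof -
  let ?S = "{p. p permutes {1..n}}"
  have S: "finite ?S" "?S \<noteq> {}" "card ?S = fact n"
    using permutes_id[of "{1..n}"]
    by (simp_all add: finite_permutations card_permutations[OF refl] ex_in_conv[symmetric] exI[of _ id])
  have "measure_pmf.prob (random_perm n) {p. P (descents n p)} = card (?S \<inter> {p. P (descents n p)}) / fact n"
    unfolding random_perm_def using S by (simp add: measure_pmf_of_set)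
  also have "real (card (?S \<inter> {p. P (descents n p)})) = (\<Sum>p\<in>?S. of_bool (P (descents n p)))"
    using S by (simp add: sum_of_bool_eq)
  also have "\<dots> = (\<Sum>xs\<in>permutations_of_set {1..n}. of_bool (P (list_descents xs)))"
    unfolding sum.reindex_bij_betw[OF permutes_bij_betw_permutations_of_set, symmetric]
    unfolding list_descents_map ..
  also have "\<dots> = fact n * (\<Sum>k\<le>n. irwin_hall n (real k + 1) * of_bool (P k))"
    by (rule sum_list_descents_eq_irwin_hall)
  finally show ?thesis by simp
qed

lemma prob_descents_ge_le_tail:
  "measure_pmf.prob (random_perm (m + 2)) {p. a \<le> descents (m + 2) p} \<le> irwin_hall_tail m (real a)"
proof -
  have "(\<Sum>k\<le>m + 2. irwin_hall (m + 2) (real k + 1) * of_bool (a \<le> k))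
      = (\<Sum>k\<in>{a..m + 2}. irwin_hall (m + 2) (real k + 1))"
    by (rule sum.mono_neutral_cong_right) auto
  also have "\<dots> = (\<Sum>j\<in>{j. a + j \<le> m + 2}. irwin_hall (m + 2) (real a + 1 + real j))"
    by (rule sum.reindex_bij_witness[of _ "\<lambda>j. a + j" "\<lambda>k. k - a"]) (auto simp: add.commute)
  also have "\<dots> \<le> irwin_hall_tail m (real a)"
    unfolding irwin_hall_tail_def by (simp, intro sum_mono2) (auto simp: irwin_hall_nonneg)
  finally show ?thesis unfolding prob_descents_eq .
qed

section \<open>The upper bound\<close>

text \<open>
  The first summand of the prefactor is at least \<open>1\<close> and the second one at least
  \<open>pi\<close>, the value of its last square root at zero tilt, while
  \<open>2 sqrt pi \<le> 1 + pi\<close> by the inequality of the arithmetic and geometric means.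
\<close>
lemma prefactor_ge:
  assumes "tilt x \<noteq> 0"
  shows "2 * sqrt pi \<le> prefactor x"
proof -
  define t where "t = tilt x"
  have pi: "3 < pi" "0 < pi" using pi_gt3 by auto
  have "0 \<le> (sqrt pi - 1)\<^sup>2" by simp
  then have "2 * sqrt pi \<le> 1 + pi"
    using pi by (simp add: power2_diff)
  also have "\<dots> = 1 + 1 * pi" by simp
  also have "\<dots> \<le> prefactor x"
    unfolding prefactor_def t_def[symmetric]
  proof (intro add_mono mult_mono)
    show "1 \<le> sqrt ((t\<^sup>2 + pi\<^sup>2) / t\<^sup>2)"
      using assms by (simp add: t_def)
    have "3\<^sup>2 < pi\<^sup>2" using pi by (intro power_strict_mono) auto
    then have "0 \<le> 2 * sqrt (t\<^sup>2 + pi\<^sup>2) / (pi\<^sup>2 - 4)" by simp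
    moreover have "0 \<le> 1 / pi" using pi by simp
    ultimately show "1 \<le> 1 + 1 / pi + 2 * sqrt (t\<^sup>2 + pi\<^sup>2) / (pi\<^sup>2 - 4)" 
      and "0 \<le> 1 + 1 / pi + 2 * sqrt (t\<^sup>2 + pi\<^sup>2) / (pi\<^sup>2 - 4)" by linarith+
    have "pi\<^sup>2 * 1 \<le> pi\<^sup>2 * ((t\<^sup>2 + 4) / 4)" by (intro mult_left_mono) auto
    then show "pi \<le> sqrt (pi\<^sup>2 * (t\<^sup>2 + 4) / 4)" by (intro real_le_rsqrt) simp
  qed (use pi in auto)
  finally show ?thesis .
qed

theorem theorem3p2:
  fixes x :: real and n :: nat
  assumes "1 / 2 < x" and "x < 1" and "n \<ge> 1"
  shows "measure_pmf.prob (random_perm n) {p. real (descents n p) / real n \<ge> x}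
         \<le> prefactor x *
             (exp (- real n * rate_fun x - ceil_gap (real n * x) * tilt x)
              / (tilt_sd x * tilt x * sqrt (2 * pi * real n)))"
proof -
  define t where "t = tilt x"
  define v where "v = tilted_var t"
  have t: "0 < t" unfolding t_def by (rule tilt_eq(1)[OF assms(1,2)])
  have v: "0 < v" unfolding v_def by (rule tilted_var_pos[OF t])
  have sd: "tilt_sd x = sqrt v" unfolding v_def t_def by (rule tilt_sd_eq[OF assms(1,2)])
  have pref: "2 * sqrt pi \<le> prefactor x" using prefactor_ge[of x] t by (simp add: t_def)
  show ?thesis
  proof (cases "n = 1")
    case True
    have "{p. real (descents n p) / real n \<ge> x} = {}"
      using assms True by (auto simp: descents_def)
    moreover have "0 \<le> prefactor x" by (rule order_trans[OF _ pref]) simp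
    ultimately show ?thesis using t v sd by (simp add: t_def)
  next
    case False
    then obtain m where n: "n = m + 2"
      using assms(3) by (metis add.commute le_add_diff_inverse2 le_neq_implies_less less_eq_Suc_le one_add_one plus_1_eq_Suc)
    \<comment> \<open>The number of descents is an integer, so the threshold can be raised to the next one; this
        is where \<open>ceil_gap\<close> enters.\<close>
    define a where "a = nat \<lceil>real n * x\<rceil>"
    have a: "real a = real n * x + ceil_gap (real n * x)"
      using assms by (simp add: a_def ceil_gap_def)
    have "x \<le> real d / real n \<longleftrightarrow> a \<le> d" for d
      using assms by (simp add: a_def nat_le_iff ceiling_le_iff field_simps)
    then have "measure_pmf.prob (random_perm n) {p. real (descents n p) / real n \<ge> x}
        = measure_pmf.prob (random_perm n) {p. a \<le> descents n p}" by simp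
    also have "\<dots> \<le> irwin_hall_tail m (real a)" unfolding n by (rule prob_descents_ge_le_tail)
    also have "\<dots> \<le> sqrt (2 / (real n * v)) * ((exp t - 1) / t) ^ n * exp (- t * real a) / t"
      using irwin_hall_tail_le[OF t, of "real a" m] by (simp add: n v_def add_ac)
    also have "((exp t - 1) / t) ^ n = exp (real n * limit_cgf t)"
      using t uniform_mgf_pos[of t] by (simp add: exp_of_nat_mult limit_cgf_eq)
    also have "sqrt (2 / (real n * v)) * exp (real n * limit_cgf t) * exp (- t * real a) / t
        = 2 * sqrt pi * (exp (real n * limit_cgf t - t * real a) / (sqrt v * t * sqrt (2 * pi * real n)))"
    proof -
      have "2 * sqrt pi = sqrt 2 * sqrt (2 * pi)" by (simp add: real_sqrt_mult)
      then show ?thesis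
        using t v assms by (simp add: exp_diff exp_minus real_sqrt_mult real_sqrt_divide field_simps)
    qed
    also have "\<dots> \<le> prefactor x * (exp (- real n * rate_fun x - ceil_gap (real n * x) * t)
        / (sqrt v * t * sqrt (2 * pi * real n)))"
    proof (intro mult_mono divide_right_mono pref)
      have "real n * rate_fun x \<le> real n * (x * t - limit_cgf t)"
        unfolding t_def by (intro mult_left_mono rate_fun_le assms) simp
      then have "real n * limit_cgf t - t * real a
          \<le> - real n * rate_fun x - ceil_gap (real n * x) * t"
        unfolding a by (simp add: algebra_simps)
      then show "exp (real n * limit_cgf t - t * real a)
          \<le> exp (- real n * rate_fun x - ceil_gap (real n * x) * t)" by simp
    qed (use t v in \<open>auto intro: order_trans[OF _ pref]\<close>)
    finally show ?thesis unfolding sd t_def .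
  qed
qed

end
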